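(* Let $0<\beta<1$ and let $$f_{D}(y;\beta,\beta)=2\sum_{j=0}^{\infty}\frac{(-y^{2})^{j}}{\Gamma(\beta j+1)(\beta j+1)(\beta j+2)}=2E_{\beta,3}(-y^{2}),\quad y>0,$$ be the Debye function of grey Brownian motion. Then for every integer $N\ge 2$, $$f_{D}(y;\beta,\beta)=-2\sum_{j=1}^{N-1}\frac{(-y^{2})^{-j}}{\Gamma(3-\beta j)}+O\left(y^{-2N}\right),\quad y\to\infty,$$ and in particular $$f_{D}(y;\beta,\beta)\sim\frac{2}{\Gamma(3-\beta)}\,y^{-2},\quad y\to\infty.$$ Moreover, for $\beta=1$, the function $f_{D}(y;1,1)=\frac{2}{y^{4}}\left(e^{-y^{2}}-1+y^{2}\right)$ satisfies $f_{D}(y;1,1)\sim 2y^{-2}$ as $y\to\infty$.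
   Context: Generalized Mittag-Leffler function: $E_{\beta,\rho}(z)=\sum_{j=0}^{\infty}\frac{z^{j}}{\Gamma(\beta j+\rho)}$ for $z\in\mathbb{C}$, $\beta>0$, $\rho\in\mathbb{C}$. The convention $1/\Gamma(x)=0$ is used at the poles $x=0,-1,-2,\dots$ of $\Gamma$. $f\sim g$ means $f(y)/g(y)\to1$. *)

theory Defs
  imports "HOL-Analysis.Analysis" "HOL-Library.Landau_Symbols"
begin

text \<open>
  Reciprocals of the Gamma function are written with the library's entire function
  \<^const>\<open>rGamma\<close>, which vanishes at the poles of \<^const>\<open>Gamma\<close>.
\<close>

definition mittag_leffler :: "real \<Rightarrow> complex \<Rightarrow> complex \<Rightarrow> complex" where
  "mittag_leffler \<beta> \<rho> z = (\<Sum>j. z ^ j * rGamma (of_real \<beta> * of_nat j + \<rho>))"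

text \<open>The Debye function of grey Brownian motion, \<open>f\<^sub>D(y; \<beta>, \<beta>)\<close>.\<close>

definition debye_grey :: "real \<Rightarrow> real \<Rightarrow> real" where
  "debye_grey \<beta> y =
     2 * (\<Sum>j. (- (y\<^sup>2)) ^ j /
              (Gamma (\<beta> * real j + 1) * (\<beta> * real j + 1) * (\<beta> * real j + 2)))"

end

theory Submission
  imports Defs "HOL-Complex_Analysis.Complex_Analysis" "HOL-Real_Asymp.Real_Asymp"
begin

text \<open>
  The recurrence \<open>E\<^bsub>\<beta>,\<rho>\<^esub>(z) = 1/\<Gamma>(\<rho>) + z E\<^bsub>\<beta>,\<rho>+\<beta>\<^esub>(z)\<close>, solved for the right-hand \<open>E\<close> and iterated
  \<open>n\<close> times, gives the expansion in powers of \<open>1/z\<close> exactly, with remainder \<open>z\<^bsup>-n\<^esup> E\<^bsub>\<beta>,\<rho>-n\<beta>\<^esub>(z)\<close>.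
  It therefore suffices that \<open>E\<^bsub>\<beta>,\<rho>\<^esub>(-x)\<close> is bounded on \<open>x \<ge> 1\<close> for every real \<open>\<rho>\<close>, including
  negative ones.

  Boundedness comes from the Mellin-Barnes integral of
  \<open>F\<^sub>\<rho>(s) = \<pi> / sin(\<pi>s) \<cdot> x\<^bsup>-s\<^esup> / \<Gamma>(\<rho> - \<beta>s)\<close> along \<open>Re s = 1/2\<close>: on that line \<open>F\<^sub>\<rho>(s)\<close> is
  \<open>O(x\<^bsup>-1/2\<^esup> exp(-\<pi>(1 - \<beta>)|Im s|))\<close>. Since \<open>F\<^sub>\<rho>(s - 1) = -x F\<^bsub>\<rho>+\<beta>\<^esub>(s)\<close>, moving the line to
  \<open>Re s = -1/2\<close> picks up the residue \<open>1/\<Gamma>(\<rho>)\<close> at \<open>0\<close> and reproduces the recurrence; iterating it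
  yields the partial sums of the power series plus a term that tends to \<open>0\<close>.
  All integrals are truncated to \<open>|Im s| \<le> T\<close>, with \<open>T \<rightarrow> \<infinity>\<close> only at the end, so that no
  improper integral is needed.
\<close>

section \<open>Growth of the reciprocal Gamma function on vertical strips\<close>

text \<open>In Euler's product, \<open>norm (rGamma z) / rGamma (Re z)\<close> has factors
  \<open>norm (z + k) / (Re z + k)\<close>, the square root of
  \<open>1 + (Im z)\<^sup>2 / (Re z + k)\<^sup>2\<close>. Each decreases in \<open>Re z\<close>, so
  the line \<open>Re z = 1\<close> is the worst case.\<close>

lemma norm_rGamma_le_rGamma_Re:
  fixes z :: complex
  assumes "Re z \<ge> 1"
  shows "norm (rGamma z) \<le> rGamma (Re z) * norm (rGamma (Complex 1 (Im z)))"
proof -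
  let ?w = "Complex 1 (Im z)"
  have factor: "norm (z + of_nat k) * (1 + real k) \<le> (Re z + real k) * norm (?w + of_nat k)" for k
  proof (rule power2_le_imp_le)
    have "(Im z)\<^sup>2 * (1 + real k)\<^sup>2 \<le> (Im z)\<^sup>2 * (Re z + real k)\<^sup>2"
      using assms by (intro mult_left_mono power_mono) auto
    then show "(norm (z + of_nat k) * (1 + real k))\<^sup>2 \<le> ((Re z + real k) * norm (?w + of_nat k))\<^sup>2"
      unfolding power_mult_distrib cmod_power2 by (simp add: algebra_simps)
  qed (use assms in auto)
  have prod_bound: "norm (pochhammer z n) * pochhammer 1 n \<le> pochhammer (Re z) n * norm (pochhammer ?w n)" for n
    unfolding pochhammer_prod prod_norm [symmetric] prod.distrib [symmetric]
    by (intro prod_mono) (use factor in \<open>auto simp: add_ac\<close>)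
  have "norm (rGamma_series z n) * rGamma_series 1 n
          \<le> rGamma_series (Re z) n * norm (rGamma_series ?w n)" for n
  proof -
    let ?c = "fact n * exp (Re z * ln (real n)) * (fact n * exp (ln (real n)))"
    have "norm (rGamma_series z n) * rGamma_series 1 n = norm (pochhammer z (n+1)) * pochhammer 1 (n+1) / ?c"
      unfolding rGamma_series_def by (simp add: norm_divide norm_mult del: pochhammer_Suc pochhammer_same)
    also have "\<dots> \<le> pochhammer (Re z) (n+1) * norm (pochhammer ?w (n+1)) / ?c"
      by (intro divide_right_mono prod_bound) auto
    also have "\<dots> = rGamma_series (Re z) n * norm (rGamma_series ?w n)"
      unfolding rGamma_series_def by (simp add: norm_divide norm_mult del: pochhammer_Suc)
    finally show ?thesis .
  qed
  moreover have "(\<lambda>n. norm (rGamma_series z n) * rGamma_series 1 n) \<longlonglongrightarrow> norm (rGamma z) * rGamma (1::real)"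
    and "(\<lambda>n. rGamma_series (Re z) n * norm (rGamma_series ?w n)) \<longlonglongrightarrow> rGamma (Re z) * norm (rGamma ?w)"
    by (intro tendsto_intros)+
  ultimately have "norm (rGamma z) * rGamma (1::real) \<le> rGamma (Re z) * norm (rGamma ?w)"
    by (intro LIMSEQ_le) auto
  then show ?thesis by simp
qed

text \<open>The reflection formula at \<open>z = \<i>t\<close> pairs \<open>1 + \<i>t\<close> with
  its conjugate, so it determines the modulus:
  \<open>\<bar>t\<bar> * (norm (rGamma (1 + \<i>t)))\<^sup>2\<close> equals
  \<open>norm (sin (\<i> * pi * t)) / pi\<close>. The square root halves the rate \<open>pi\<close>
  of the sine. Compactness handles small \<open>t\<close>, where the factor
  \<open>\<bar>t\<bar>\<close> is below 1.\<close>

lemma rGamma_vertical_line_bound: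
  obtains C where "C > 0" "\<And>t. norm (rGamma (Complex 1 t)) \<le> C * exp (pi / 2 * \<bar>t\<bar>)"
proof -
  have "compact ((\<lambda>t. rGamma (Complex 1 t)) ` {-1..1})"
  proof (rule compact_continuous_image)
    have "continuous_on {-1..1} (\<lambda>t. rGamma (1 + \<i> * of_real t))"
      by (intro continuous_on_compose2[OF continuous_on_rGamma[of UNIV]] continuous_intros) auto
    then show "continuous_on {-1..1} (\<lambda>t. rGamma (Complex 1 t))" by (simp add: Complex_eq)
  qed auto
  then obtain B where B: "\<And>t. t \<in> {-1..1} \<Longrightarrow> norm (rGamma (Complex 1 t)) \<le> B"
    unfolding compact_eq_bounded_closed bounded_iff by fastforce
  have large: "norm (rGamma (Complex 1 t)) \<le> exp (pi / 2 * \<bar>t\<bar>)" if t: "\<bar>t\<bar> \<ge> 1" for t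
  proof -
    let ?z = "Complex 0 t"
    have "?z * rGamma (?z + 1) * rGamma (1 - ?z) = sin (of_real pi * ?z) / of_real pi"
      by (simp only: rGamma_plus1 rGamma_reflection_complex)
    then have "norm (?z * rGamma (?z + 1) * rGamma (1 - ?z)) = norm (sin (of_real pi * ?z)) / pi"
      by (simp add: norm_divide)
    moreover have "?z + 1 = Complex 1 t" "1 - ?z = cnj (Complex 1 t)" by (simp_all add: complex_eq_iff)
    ultimately have "\<bar>t\<bar> * (norm (rGamma (Complex 1 t)))\<^sup>2 = norm (sin (of_real pi * ?z)) / pi"
      by (simp only: norm_mult cnj_rGamma [symmetric] complex_mod_cnj mult.assoc power2_eq_square)
         (simp add: cmod_def)
    also have "norm (sin (of_real pi * ?z)) \<le> exp (pi * \<bar>t\<bar>)"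
      using cmod_sin_le_exp[of 1 "of_real pi * ?z"] by (simp add: abs_mult)
    also have "exp (pi * \<bar>t\<bar>) / pi \<le> exp (pi * \<bar>t\<bar>)"
      using pi_ge_two by (simp add: divide_le_eq)
    finally have "\<bar>t\<bar> * (norm (rGamma (Complex 1 t)))\<^sup>2 \<le> exp (pi * \<bar>t\<bar>)"
      by (simp add: divide_right_mono)
    moreover have "1 * (norm (rGamma (Complex 1 t)))\<^sup>2 \<le> \<bar>t\<bar> * (norm (rGamma (Complex 1 t)))\<^sup>2"
      by (intro mult_right_mono t) auto
    ultimately have "(norm (rGamma (Complex 1 t)))\<^sup>2 \<le> (exp (pi / 2 * \<bar>t\<bar>))\<^sup>2"
      by (simp add: exp_double [symmetric])
    then show ?thesis by (rule power2_le_imp_le) auto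
  qed
  show thesis
  proof (rule that[of "max 1 B"])
    fix t :: real
    show "norm (rGamma (Complex 1 t)) \<le> max 1 B * exp (pi / 2 * \<bar>t\<bar>)"
    proof (cases "\<bar>t\<bar> \<ge> 1")
      case True
      have "1 * exp (pi / 2 * \<bar>t\<bar>) \<le> max 1 B * exp (pi / 2 * \<bar>t\<bar>)"
        by (intro mult_right_mono) auto
      with large[OF True] show ?thesis by linarith
    next
      case False
      then have "norm (rGamma (Complex 1 t)) \<le> max 1 B * 1" unfolding mult_1_right by (intro max.coboundedI2 B) auto
      also have "max 1 B * 1 \<le> max 1 B * exp (pi / 2 * \<bar>t\<bar>)" by (intro mult_left_mono) auto
      finally show ?thesis .
    qed
  qed auto
qed

lemma rGamma_real_nonneg: "x > 0 \<Longrightarrow> rGamma (x::real) \<ge> 0"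
  by (simp add: rGamma_inverse_Gamma Gamma_real_nonneg)

text \<open>The factor \<open>rGamma (Re z)\<close> is kept explicit so that \<open>C\<close> is
  uniform in the whole half-plane; this is what survives when the parameter \<rho> + \<beta>M tends
  to infinity.\<close>

lemma rGamma_half_plane_bound:
  obtains C where "C > 0"
    "\<And>z::complex. Re z \<ge> 1 \<Longrightarrow> norm (rGamma z) \<le> C * rGamma (Re z) * exp (pi / 2 * \<bar>Im z\<bar>)"
proof -
  obtain C where C: "C > 0" "\<And>t. norm (rGamma (Complex 1 t)) \<le> C * exp (pi / 2 * \<bar>t\<bar>)"
    by (rule rGamma_vertical_line_bound) blast
  have "norm (rGamma z) \<le> C * rGamma (Re z) * exp (pi / 2 * \<bar>Im z\<bar>)" if "Re z \<ge> 1" for z :: complex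
  proof -
    have "norm (rGamma z) \<le> rGamma (Re z) * norm (rGamma (Complex 1 (Im z)))"
      by (rule norm_rGamma_le_rGamma_Re) fact
    also have "\<dots> \<le> rGamma (Re z) * (C * exp (pi / 2 * \<bar>Im z\<bar>))"
      using that by (intro mult_left_mono C rGamma_real_nonneg) auto
    finally show ?thesis by (simp add: mult_ac)
  qed
  with that C show thesis by blast
qed

text \<open>The recursion for \<open>1/\<Gamma>\<close> costs a polynomial factor at each step to the left, which is absorbed
  by an arbitrarily small increase of the exponential rate; hence the free \<open>c\<close>.\<close>

lemma rGamma_strip_bound_aux:
  assumes "c > pi / 2"
  shows "\<exists>C. \<forall>z::complex. 1 - real m \<le> Re z \<and> Re z \<le> R \<longrightarrow> norm (rGamma z) \<le> C * exp (c * \<bar>Im z\<bar>)"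
  using assms
proof (induction m arbitrary: c R)
  case 0
  obtain C where C: "C > 0"
    "\<And>z::complex. Re z \<ge> 1 \<Longrightarrow> norm (rGamma z) \<le> C * rGamma (Re z) * exp (pi / 2 * \<bar>Im z\<bar>)"
    by (rule rGamma_half_plane_bound) blast
  have "compact (rGamma ` {1..R})"
    by (intro compact_continuous_image continuous_on_rGamma) auto
  then obtain B where B: "\<And>t. t \<in> {1..R} \<Longrightarrow> norm (rGamma t) \<le> B"
    unfolding compact_eq_bounded_closed bounded_iff by fastforce
  have "norm (rGamma z) \<le> C * max 0 B * exp (c * \<bar>Im z\<bar>)" if z: "1 \<le> Re z" "Re z \<le> R" for z :: complex
  proof -
    have "norm (rGamma z) \<le> C * rGamma (Re z) * exp (pi / 2 * \<bar>Im z\<bar>)" using C z by blast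
    also have "\<dots> \<le> C * max 0 B * exp (c * \<bar>Im z\<bar>)"
      using B[of "Re z"] z C(1) mult_right_mono[OF less_imp_le[OF 0], of "\<bar>Im z\<bar>"] rGamma_real_nonneg[of "Re z"]
      by (intro mult_mono) (auto intro: mult_right_mono)
    finally show ?thesis .
  qed
  then show ?case by auto
next
  case (Suc m)
  define d where "d = (c - pi / 2) / 2"
  have d: "d > 0" "c - d > pi / 2" using Suc.prems by (auto simp: d_def field_simps)
  from Suc.IH[OF d(2), of "R + 1"] obtain C where
    C: "\<And>z::complex. 1 - real m \<le> Re z \<Longrightarrow> Re z \<le> R + 1 \<Longrightarrow> norm (rGamma z) \<le> C * exp ((c - d) * \<bar>Im z\<bar>)"
    by blast
  \<comment> \<open>The maximum bounds \<open>\<bar>Re z\<bar>\<close> on the strip;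
    \<open>1 / d\<close> comes from
    \<open>d * \<bar>Im z\<bar> \<le> exp (d * \<bar>Im z\<bar>)\<close>.\<close>
  define K where "K = max 1 (real m + \<bar>R\<bar>) + 1 / d"
  have "norm (rGamma z) \<le> K * C * exp (c * \<bar>Im z\<bar>)" if z: "1 - real (Suc m) \<le> Re z" "Re z \<le> R" for z :: complex
  proof -
    have "norm z \<le> \<bar>Re z\<bar> + \<bar>Im z\<bar>" by (rule cmod_le)
    also have "\<dots> \<le> max 1 (real m + \<bar>R\<bar>) * 1 + 1 / d * (d * \<bar>Im z\<bar>)" using z d by auto
    also have "\<dots> \<le> max 1 (real m + \<bar>R\<bar>) * exp (d * \<bar>Im z\<bar>) + 1 / d * exp (d * \<bar>Im z\<bar>)"
      using d exp_ge_add_one_self[of "d * \<bar>Im z\<bar>"]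
      by (intro add_mono mult_left_mono) (auto intro: order_trans[OF _ exp_ge_add_one_self])
    finally have nz: "norm z \<le> K * exp (d * \<bar>Im z\<bar>)" by (simp add: K_def algebra_simps)
    have "rGamma z = z * rGamma (z + 1)" by (rule rGamma_plus1 [symmetric])
    then have "norm (rGamma z) = norm z * norm (rGamma (z + 1))" by (simp add: norm_mult)
    also have "\<dots> \<le> (K * exp (d * \<bar>Im z\<bar>)) * (C * exp ((c - d) * \<bar>Im (z + 1)\<bar>))"
      using z by (intro mult_mono nz C) (auto intro: order_trans[OF norm_ge_zero nz])
    also have "\<dots> = K * C * exp (c * \<bar>Im z\<bar>)" by (simp add: exp_add [symmetric] algebra_simps)
    finally show ?thesis .
  qed
  then show ?case by blast
qed

text \<open>Rate \<open>pi\<close> is small enough: the integrand evaluates \<open>rGamma\<close> at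
  imaginary part -\<beta>t, and growth \<open>exp (pi * \<beta> * \<bar>t\<bar>)\<close> with
  \<beta> < 1 loses to the decay \<open>exp (- pi * \<bar>t\<bar>)\<close> of the reciprocal
  sine.\<close>

lemma rGamma_strip_bound:
  obtains C where "C > 0" "\<And>z::complex. L \<le> Re z \<Longrightarrow> Re z \<le> R \<Longrightarrow> norm (rGamma z) \<le> C * exp (pi * \<bar>Im z\<bar>)"
proof -
  obtain m where m: "1 - L \<le> real m" by (meson real_arch_simple)
  have "pi > pi / 2" by simp
  from rGamma_strip_bound_aux[OF this, of m R] obtain C where
    C: "\<And>z::complex. 1 - real m \<le> Re z \<Longrightarrow> Re z \<le> R \<Longrightarrow> norm (rGamma z) \<le> C * exp (pi * \<bar>Im z\<bar>)"
    by blast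
  have "norm (rGamma z) \<le> max 1 C * exp (pi * \<bar>Im z\<bar>)" if "L \<le> Re z" "Re z \<le> R" for z :: complex
  proof -
    have "norm (rGamma z) \<le> C * exp (pi * \<bar>Im z\<bar>)" using that m by (intro C) auto
    also have "\<dots> \<le> max 1 C * exp (pi * \<bar>Im z\<bar>)" by (intro mult_right_mono) auto
    finally show ?thesis .
  qed
  then show thesis by (intro that[of "max 1 C"]) auto
qed

section \<open>The Mittag-Leffler series on the real line\<close>

text \<open>Log-convexity of \<open>Gamma\<close>, with \<open>a + 1\<close> written as the convex
  combination of \<open>a + \<beta>\<close> and \<open>a + \<beta> + 1\<close> with weights \<beta>
  and 1 - \<beta>.\<close>

lemma Gamma_real_add_ge:
  fixes a \<beta> :: real
  assumes a: "a > 0" and \<beta>: "0 < \<beta>" "\<beta> \<le> 1"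
  shows "Gamma (a + \<beta>) \<ge> a * (a + \<beta>) powr (\<beta> - 1) * Gamma a"
proof -
  have eqs: "(1 - (1 - \<beta>)) *\<^sub>R (a + \<beta>) + (1 - \<beta>) *\<^sub>R (a + \<beta> + 1) = a + 1"
    "Gamma (a + \<beta> + 1) = (a + \<beta>) * Gamma (a + \<beta>)" "Gamma (a + 1) = a * Gamma a"
    subgoal by (simp add: algebra_simps)
    subgoal using a \<beta> by (intro Gamma_plus1) (auto elim!: nonpos_Ints_cases)
    subgoal using a by (intro Gamma_plus1) (auto elim!: nonpos_Ints_cases)
    done
  have "(ln \<circ> Gamma) ((1 - (1 - \<beta>)) *\<^sub>R (a + \<beta>) + (1 - \<beta>) *\<^sub>R (a + \<beta> + 1))
          \<le> (1 - (1 - \<beta>)) * (ln \<circ> Gamma) (a + \<beta>) + (1 - \<beta>) * (ln \<circ> Gamma) (a + \<beta> + 1)"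
    by (rule convex_onD[OF log_convex_Gamma_real]) (use a \<beta> in auto)
  then have "ln (a * Gamma a) \<le> \<beta> * ln (Gamma (a + \<beta>)) + (1 - \<beta>) * ln ((a + \<beta>) * Gamma (a + \<beta>))"
    by (simp only: eqs o_def) simp
  moreover have "ln ((a + \<beta>) * Gamma (a + \<beta>)) = ln (a + \<beta>) + ln (Gamma (a + \<beta>))"
    using a \<beta> Gamma_real_pos[of "a + \<beta>"] by (intro ln_mult_pos) auto
  ultimately have "ln (a * Gamma a) \<le> ln (Gamma (a + \<beta>)) + (1 - \<beta>) * ln (a + \<beta>)"
    by (simp add: algebra_simps)
  then have "exp (ln (a * Gamma a)) \<le> exp (ln (Gamma (a + \<beta>)) + (1 - \<beta>) * ln (a + \<beta>))"
    by simp
  then have "a * Gamma a \<le> Gamma (a + \<beta>) * (a + \<beta>) powr (1 - \<beta>)"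
    using a \<beta> Gamma_real_pos[of "a + \<beta>"] Gamma_real_pos[of a] by (simp add: exp_add powr_def)
  then have "a * Gamma a * (a + \<beta>) powr (\<beta> - 1)
      \<le> Gamma (a + \<beta>) * (a + \<beta>) powr (1 - \<beta>) * (a + \<beta>) powr (\<beta> - 1)"
    by (intro mult_right_mono) auto
  also have "\<dots> = Gamma (a + \<beta>)" using a \<beta> by (simp add: powr_add [symmetric] mult.assoc)
  finally show ?thesis by (simp add: mult_ac)
qed

text \<open>Ratio test: by \<open>Gamma_real_add_ge\<close> the ratio of consecutive terms is at
  most \<open>\<bar>x\<bar> * (a + \<beta>) powr (1 - \<beta>) / a\<close> with
  \<open>a = \<beta> * j + \<rho>\<close>, which tends to 0 like
  \<open>a powr (- \<beta>)\<close>.\<close>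

lemma summable_mittag_leffler_real:
  fixes \<beta> \<rho> x :: real
  assumes \<beta>: "0 < \<beta>" "\<beta> \<le> 1"
  shows "summable (\<lambda>j. x ^ j * rGamma (\<beta> * real j + \<rho>))"
proof -
  have "filterlim (\<lambda>a. a * (a + \<beta>) powr (\<beta> - 1)) at_top at_top"
    using \<beta> by real_asymp
  then have "eventually (\<lambda>a. a * (a + \<beta>) powr (\<beta> - 1) \<ge> 2 * \<bar>x\<bar> + 1) at_top"
    by (simp add: filterlim_at_top)
  moreover have "filterlim (\<lambda>j. \<beta> * real j + \<rho>) at_top sequentially"
    using \<beta> by real_asymp
  ultimately have "eventually (\<lambda>j. let a = \<beta> * real j + \<rho> in
      a * (a + \<beta>) powr (\<beta> - 1) \<ge> 2 * \<bar>x\<bar> + 1 \<and> a > 0) sequentially"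
    unfolding Let_def
    by (intro eventually_conj) (auto intro: eventually_compose_filterlim simp: filterlim_at_top_dense)
  then obtain N where N: "\<And>j. j \<ge> N \<Longrightarrow> let a = \<beta> * real j + \<rho> in
      a * (a + \<beta>) powr (\<beta> - 1) \<ge> 2 * \<bar>x\<bar> + 1 \<and> a > 0"
    unfolding eventually_sequentially by blast
  show ?thesis
  proof (rule summable_ratio_test[of "1/2" N])
    fix j assume "N \<le> j"
    define a where "a = \<beta> * real j + \<rho>"
    have a: "a * (a + \<beta>) powr (\<beta> - 1) \<ge> 2 * \<bar>x\<bar> + 1" "a > 0"
      using N[OF \<open>N \<le> j\<close>] by (auto simp: a_def Let_def)
    have pos: "Gamma a > 0" "Gamma (a + \<beta>) > 0" using a \<beta> by auto
    have "2 * \<bar>x\<bar> * Gamma a \<le> a * (a + \<beta>) powr (\<beta> - 1) * Gamma a"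
      using a pos by (intro mult_right_mono) auto
    also have "\<dots> \<le> Gamma (a + \<beta>)" by (rule Gamma_real_add_ge) (use a \<beta> in auto)
    finally have "\<bar>x\<bar> * rGamma (a + \<beta>) \<le> 1 / 2 * rGamma a"
      using pos by (simp add: rGamma_inverse_Gamma field_simps)
    then have "\<bar>x\<bar> ^ j * (\<bar>x\<bar> * rGamma (a + \<beta>)) \<le> \<bar>x\<bar> ^ j * (1 / 2 * rGamma a)"
      by (intro mult_left_mono) auto
    moreover have "\<beta> * real (Suc j) + \<rho> = a + \<beta>" by (simp add: a_def algebra_simps)
    ultimately show "norm (x ^ Suc j * rGamma (\<beta> * real (Suc j) + \<rho>))
        \<le> 1 / 2 * norm (x ^ j * rGamma (\<beta> * real j + \<rho>))"
      using pos unfolding a_def [symmetric]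
      by (simp add: abs_mult power_abs rGamma_inverse_Gamma mult_ac)
  qed simp
qed

lemma has_integral_exp_abs:
  fixes d T :: real
  assumes "d > 0" "T \<ge> 0"
  shows "((\<lambda>t. exp (- d * \<bar>t\<bar>)) has_integral 2 * (1 - exp (- d * T)) / d) {-T..T}"
proof -
  have "((\<lambda>t. exp (d * t)) has_integral (exp (d * 0) / d - exp (d * (-T)) / d)) {-T..0}"
    using assms by (intro fundamental_theorem_of_calculus)
      (auto intro!: derivative_eq_intros simp: has_real_derivative_iff_has_vector_derivative [symmetric])
  then have neg: "((\<lambda>t. exp (- d * \<bar>t\<bar>)) has_integral ((1 - exp (- d * T)) / d)) {-T..0}"
    by (rule has_integral_eq_rhs[OF has_integral_eq[rotated]]) (auto simp: diff_divide_distrib)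
  have "((\<lambda>t. exp (- d * t)) has_integral (- exp (- d * T) / d - (- exp (- d * 0) / d))) {0..T}"
    using assms by (intro fundamental_theorem_of_calculus)
      (auto intro!: derivative_eq_intros simp: has_real_derivative_iff_has_vector_derivative [symmetric])
  then have pos: "((\<lambda>t. exp (- d * \<bar>t\<bar>)) has_integral ((1 - exp (- d * T)) / d)) {0..T}"
    by (rule has_integral_eq_rhs[OF has_integral_eq[rotated]]) (auto simp: diff_divide_distrib)
  show ?thesis
    using has_integral_combine[OF _ _ neg pos] assms by simp
qed

section \<open>The real Mittag-Leffler function: recurrence and exact expansion in negative
  powers\<close>

definition mittag_leffler_real :: "real \<Rightarrow> real \<Rightarrow> real \<Rightarrow> real" where
  "mittag_leffler_real \<beta> \<rho> x = (\<Sum>j. x ^ j * rGamma (\<beta> * real j + \<rho>))"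

lemma mittag_leffler_of_real:
  assumes "0 < \<beta>" "\<beta> \<le> 1"
  shows "mittag_leffler \<beta> (of_real \<rho>) (of_real x) = of_real (mittag_leffler_real \<beta> \<rho> x)"
proof -
  have "(\<lambda>j. x ^ j * rGamma (\<beta> * real j + \<rho>)) sums mittag_leffler_real \<beta> \<rho> x"
    unfolding mittag_leffler_real_def by (intro summable_sums summable_mittag_leffler_real assms)
  then have "(\<lambda>j. complex_of_real (x ^ j * rGamma (\<beta> * real j + \<rho>))) sums of_real (mittag_leffler_real \<beta> \<rho> x)"
    by (subst sums_of_real_iff)
  then show ?thesis
    unfolding mittag_leffler_def by (intro sums_unique [symmetric]) (simp flip: rGamma_complex_of_real)
qed

lemma mittag_leffler_real_shift:
  assumes "0 < \<beta>" "\<beta> \<le> 1"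
  shows "mittag_leffler_real \<beta> \<rho> x = rGamma \<rho> + x * mittag_leffler_real \<beta> (\<rho> + \<beta>) x"
proof -
  have "mittag_leffler_real \<beta> \<rho> x = rGamma \<rho> + (\<Sum>j. x ^ Suc j * rGamma (\<beta> * real (Suc j) + \<rho>))"
    unfolding mittag_leffler_real_def by (subst suminf_split_head[OF summable_mittag_leffler_real[OF assms]]) simp_all
  also have "(\<Sum>j. x ^ Suc j * rGamma (\<beta> * real (Suc j) + \<rho>)) = x * mittag_leffler_real \<beta> (\<rho> + \<beta>) x"
    unfolding mittag_leffler_real_def by (subst suminf_mult [symmetric, OF summable_mittag_leffler_real[OF assms]])
      (simp add: algebra_simps)
  finally show ?thesis .
qed

text \<open>Each induction step applies \<open>mittag_leffler_real_shift\<close> from right to left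
  to the remainder, lowering its parameter by a further \<beta>; hence parameters of any sign
  occur.\<close>

lemma mittag_leffler_real_expansion:
  assumes \<beta>: "0 < \<beta>" "\<beta> \<le> 1" and x: "x \<noteq> 0"
  shows "mittag_leffler_real \<beta> \<rho> x = x powi (- int n) * mittag_leffler_real \<beta> (\<rho> - \<beta> * real n) x
           - (\<Sum>j=1..n. x powi (- int j) * rGamma (\<rho> - \<beta> * real j))"
proof (induction n)
  case (Suc n)
  let ?r = "\<rho> - \<beta> * real (Suc n)"
  have "mittag_leffler_real \<beta> ?r x = rGamma ?r + x * mittag_leffler_real \<beta> (\<rho> - \<beta> * real n) x"
    using mittag_leffler_real_shift[OF \<beta>, of ?r x] by (simp add: algebra_simps)
  then have "mittag_leffler_real \<beta> (\<rho> - \<beta> * real n) x = x powi (-1) * (mittag_leffler_real \<beta> ?r x - rGamma ?r)"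
    using x by (simp add: field_simps)
  moreover have "x powi (- int (Suc n)) = x powi (- int n) * x powi (-1)"
    using power_int_add[of x "- int n" "- 1"] x by (simp add: algebra_simps)
  ultimately show ?case using Suc.IH by (simp add: right_diff_distrib mult.assoc)
qed simp

section \<open>The truncated Mellin-Barnes integral\<close>

text \<open>The last factor is the power of \<open>x\<close> with exponent \<open>- s\<close>, for
  \<open>x > 0\<close>. As \<open>pi / sin (pi * s)\<close> has residue \<open>(-1) ^ j\<close> at
  \<open>s = - j\<close>, the residue of the integrand there is
  \<open>(- x) ^ j * rGamma (\<rho> + \<beta> * j)\<close>, the \<open>j\<close>-th term of the
  series at \<open>- x\<close>.\<close>

definition mb_integrand :: "real \<Rightarrow> real \<Rightarrow> real \<Rightarrow> complex \<Rightarrow> complex" where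
  "mb_integrand \<beta> \<rho> x s =
     of_real pi / sin (of_real pi * s) * rGamma (of_real \<rho> - of_real \<beta> * s) * exp (- s * of_real (ln x))"

text \<open>Integrals over \<open>Re s = - 1/2\<close> thereby become integrals over
  \<open>Re s = 1/2\<close> with parameter \<rho> + \<beta>, so a single vertical line serves for
  all shifts.\<close>

lemma mb_integrand_diff_1:
  assumes "x > 0"
  shows "mb_integrand \<beta> \<rho> x (s - 1) = - of_real x * mb_integrand \<beta> (\<rho> + \<beta>) x s"
proof -
  have "sin (of_real pi * (s - 1)) = - sin (of_real pi * s)"
    by (simp add: ring_distribs sin_diff flip: sin_of_real cos_of_real)
  moreover have "of_real \<rho> - of_real \<beta> * (s - 1) = of_real (\<rho> + \<beta>) - of_real \<beta> * s"
    by (simp add: algebra_simps)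
  moreover have "exp (- (s - 1) * of_real (ln x)) = of_real x * exp (- s * of_real (ln x))"
    using assms by (simp add: ring_distribs exp_diff exp_minus exp_of_real field_simps)
  ultimately show ?thesis unfolding mb_integrand_def by (simp only:) simp
qed

lemma sin_pi_times_strip_nonzero:
  assumes "s \<noteq> 0" "\<bar>Re s\<bar> < 1"
  shows "sin (of_real pi * s :: complex) \<noteq> 0"
proof
  assume "sin (of_real pi * s) = 0"
  then obtain n :: int where "of_real pi * s = of_real (of_int n * pi)"
    unfolding sin_eq_0 by auto
  then have "s = of_int n" by simp
  with assms show False by simp
qed

lemma continuous_on_mb_integrand:
  assumes "A \<subseteq> {s. \<bar>Re s\<bar> < 1} - {0}"
  shows "continuous_on A (mb_integrand \<beta> \<rho> x)"
  unfolding mb_integrand_def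
  by (intro continuous_intros continuous_on_compose2[OF continuous_on_rGamma[of UNIV]])
     (use assms sin_pi_times_strip_nonzero in auto)

text \<open>Triangle inequality for the two exponentials in the sine. The bound degenerates on the
  real axis, so it serves for the horizontal sides of the contour.\<close>

lemma norm_sin_ge: "(exp \<bar>Im z\<bar> - 1) / 2 \<le> norm (sin z)" for z :: complex
proof -
  have "norm (sin z) = norm (exp (\<i> * z) - exp (- (\<i> * z))) / 2"
    by (simp add: sin_exp_eq norm_divide norm_mult)
  moreover have "\<bar>norm (exp (\<i> * z)) - norm (exp (- (\<i> * z)))\<bar> \<le> norm (exp (\<i> * z) - exp (- (\<i> * z)))"
    by (rule norm_triangle_ineq3)
  moreover have "\<bar>exp (- Im z) - exp (Im z)\<bar> \<ge> exp \<bar>Im z\<bar> - 1"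
    by (cases "Im z \<ge> 0") (auto simp: abs_if)
  ultimately show ?thesis by simp
qed

text \<open>On this line the sine has modulus \<open>cosh (pi * t)\<close>, so the bound holds down
  to \<open>t = 0\<close>.\<close>

lemma norm_sin_vertical_ge: "exp (pi * \<bar>t\<bar>) / 2 \<le> norm (sin (of_real pi * Complex (1 / 2) t))"
proof (rule power2_le_imp_le)
  have "(exp (pi * \<bar>t\<bar>))\<^sup>2 = exp (2 * (pi * \<bar>t\<bar>))" by (simp add: exp_double)
  also have "\<dots> \<le> exp (2 * (pi * t)) + exp (- (2 * (pi * t))) + 2"
    by (cases "t \<ge> 0") (simp_all add: abs_if add_increasing add_increasing2)
  \<comment> \<open>The \<open>+ 2\<close> is \<open>- 2 * cos (2 * Re z)\<close> at
    \<open>Re z = pi / 2\<close>.\<close>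
  also have "\<dots> = 4 * (norm (sin (of_real pi * Complex (1 / 2) t)))\<^sup>2"
    by (simp add: norm_sin_squared exp_minus)
  finally show "(exp (pi * \<bar>t\<bar>) / 2)\<^sup>2 \<le> (norm (sin (of_real pi * Complex (1 / 2) t)))\<^sup>2"
    by (simp add: power_divide)
qed auto

lemma norm_mb_integrand:
  "norm (mb_integrand \<beta> \<rho> x s) =
     pi / norm (sin (of_real pi * s)) * norm (rGamma (of_real \<rho> - of_real \<beta> * s)) * exp (- Re s * ln x)"
  by (simp add: mb_integrand_def norm_mult norm_divide)

text \<open>Integration is in the real variable \<open>t\<close>: the factor \<i> of
  \<open>ds = \<i> dt\<close> and the normalisation by \<open>2 * pi * \<i>\<close> are left out,
  hence the factors \<open>2 * pi\<close> in the limits below.\<close>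

definition mb_integral :: "real \<Rightarrow> real \<Rightarrow> real \<Rightarrow> real \<Rightarrow> complex" where
  "mb_integral \<beta> \<rho> x T = integral {-T..T} (\<lambda>t. mb_integrand \<beta> \<rho> x (Complex (1 / 2) t))"

text \<open>The estimate is uniform in \<open>T\<close>, and \<open>C\<close> is a parameter because
  it is applied both with a constant for fixed \<rho> and with one that involves
  \<open>rGamma\<close> at a large real argument.\<close>

lemma norm_mb_integral_le:
  assumes \<beta>: "0 < \<beta>" "\<beta> < 1" and x: "x > 0" and T: "T \<ge> 0"
    and C: "\<And>z. Re z = \<rho> - \<beta> / 2 \<Longrightarrow> norm (rGamma z) \<le> C * exp (pi * \<bar>Im z\<bar>)"
  shows "norm (mb_integral \<beta> \<rho> x T) \<le> 4 * C / (1 - \<beta>) / sqrt x"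
proof -
  \<comment> \<open>Net decay rate: \<open>pi\<close> from the sine minus
    \<open>pi * \<beta>\<close> from \<open>rGamma\<close>.\<close>
  define d where "d = pi * (1 - \<beta>)"
  have d: "d > 0" using \<beta> by (simp add: d_def)
  have C0: "C \<ge> 0" using C[of "of_real (\<rho> - \<beta> / 2)"] by (auto intro: order_trans[OF norm_ge_zero])
  have bound: "norm (mb_integrand \<beta> \<rho> x (Complex (1 / 2) t)) \<le> 2 * pi * C / sqrt x * exp (- d * \<bar>t\<bar>)" for t
  proof -
    let ?s = "Complex (1 / 2) t"
    have "exp (- Re ?s * ln x) = 1 / sqrt x"
      using x by (simp add: powr_half_sqrt [symmetric] powr_def exp_minus field_simps)
    moreover have "norm (rGamma (of_real \<rho> - of_real \<beta> * ?s)) \<le> C * exp (pi * (\<beta> * \<bar>t\<bar>))"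
      using C[of "of_real \<rho> - of_real \<beta> * ?s"] \<beta> by (simp add: abs_mult)
    moreover have "pi / norm (sin (of_real pi * ?s)) \<le> pi / (exp (pi * \<bar>t\<bar>) / 2)"
      by (intro divide_left_mono norm_sin_vertical_ge mult_pos_pos less_le_trans[OF _ norm_sin_vertical_ge]) auto
    ultimately have "norm (mb_integrand \<beta> \<rho> x ?s)
        \<le> pi / (exp (pi * \<bar>t\<bar>) / 2) * (C * exp (pi * (\<beta> * \<bar>t\<bar>))) * (1 / sqrt x)"
      using x C0 unfolding norm_mb_integrand by (intro mult_mono) auto
    also have "\<dots> = 2 * pi * C / sqrt x * exp (- d * \<bar>t\<bar>)"
      by (simp add: d_def algebra_simps exp_diff)
    finally show ?thesis .
  qed
  have int: "((\<lambda>t. 2 * pi * C / sqrt x * exp (- d * \<bar>t\<bar>)) has_integral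
      2 * pi * C / sqrt x * (2 * (1 - exp (- d * T)) / d)) {-T..T}"
    by (intro has_integral_mult_right has_integral_exp_abs d T)
  have "continuous_on {-T..T} (\<lambda>t. mb_integrand \<beta> \<rho> x (1 / 2 + \<i> * of_real t))"
    by (intro continuous_on_compose2[OF continuous_on_mb_integrand[OF subset_refl]] continuous_intros)
       (auto simp: complex_eq_iff)
  then have "(\<lambda>t. mb_integrand \<beta> \<rho> x (Complex (1 / 2) t)) integrable_on {-T..T}"
    by (intro integrable_continuous_real) (simp add: Complex_eq)
  then have "norm (mb_integral \<beta> \<rho> x T) \<le> integral {-T..T} (\<lambda>t. 2 * pi * C / sqrt x * exp (- d * \<bar>t\<bar>))"
    unfolding mb_integral_def using int bound by (intro integral_norm_bound_integral) auto
  also have "\<dots> = 2 * pi * C / sqrt x * (2 * (1 - exp (- d * T)) / d)"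
    using int by (rule integral_unique)
  also have "\<dots> \<le> 2 * pi * C / sqrt x * (2 * 1 / d)"
    using d C0 x by (intro mult_left_mono divide_right_mono) auto
  also have "\<dots> = 4 * C / (1 - \<beta>) / sqrt x" by (simp add: d_def)
  finally show ?thesis .
qed

text \<open>For \<beta> < 1 the bound vanishes as \<open>T\<close> grows. The factor
  \<open>exp \<bar>ln x\<bar>\<close> majorizes the power of \<open>x\<close> for either sign of
  \<open>ln x\<close>.\<close>

lemma norm_mb_integrand_horizontal_le:
  assumes \<beta>: "0 < \<beta>" "\<beta> < 1" and T: "T > 0" and s: "\<bar>Re s\<bar> \<le> 1 / 2" "\<bar>Im s\<bar> = T"
    and C: "\<And>z. Re z \<ge> \<rho> - 1 \<Longrightarrow> Re z \<le> \<rho> + 1 \<Longrightarrow> norm (rGamma z) \<le> C * exp (pi * \<bar>Im z\<bar>)"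
  shows "norm (mb_integrand \<beta> \<rho> x s) \<le> 2 * pi / (exp (pi * T) - 1) * (C * exp (pi * (\<beta> * T))) * exp \<bar>ln x\<bar>"
proof -
  have C0: "C \<ge> 0" using C[of "of_real \<rho>"] by (auto intro: order_trans[OF norm_ge_zero])
  have *: "\<bar>\<beta> * Re s\<bar> \<le> 1 * 1" unfolding abs_mult using \<beta> s by (intro mult_mono) auto
  then have **: "\<beta> * Re s \<le> 1" "- 1 \<le> \<beta> * Re s" by linarith+
  have "norm (rGamma (of_real \<rho> - of_real \<beta> * s)) \<le> C * exp (pi * (\<beta> * T))"
    using C[of "of_real \<rho> - of_real \<beta> * s"] \<beta> s(2) ** by (simp add: abs_mult)
  moreover have "- Re s * ln x \<le> \<bar>ln x\<bar>"
  proof -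
    have "\<bar>- Re s * ln x\<bar> \<le> 1 * \<bar>ln x\<bar>" unfolding abs_mult using s by (intro mult_right_mono) auto
    then show ?thesis by linarith
  qed
  moreover have "pi / norm (sin (of_real pi * s)) \<le> pi / ((exp (pi * T) - 1) / 2)"
  proof (rule divide_left_mono)
    show "(exp (pi * T) - 1) / 2 \<le> norm (sin (of_real pi * s))"
      using norm_sin_ge[of "of_real pi * s"] s by (simp add: abs_mult)
    moreover have "(exp (pi * T) - 1) / 2 > 0" using T by simp
    ultimately show "0 < norm (sin (of_real pi * s)) * ((exp (pi * T) - 1) / 2)"
      by (intro mult_pos_pos) auto
  qed simp
  ultimately have "norm (mb_integrand \<beta> \<rho> x s)
      \<le> pi / ((exp (pi * T) - 1) / 2) * (C * exp (pi * (\<beta> * T))) * exp \<bar>ln x\<bar>"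
    unfolding norm_mb_integrand using T C0 by (intro mult_mono) auto
  then show ?thesis by (simp add: mult_ac)
qed

section \<open>Shifting the contour across the pole at 0\<close>

lemma mb_integrand_residue:
  assumes "s \<noteq> 0" "\<bar>Re s\<bar> < 1"
  shows "Gamma (1 + s) * Gamma (1 - s) * rGamma (of_real \<rho> - of_real \<beta> * s) * exp (- s * of_real (ln x)) / s
           = mb_integrand \<beta> \<rho> x s"
proof -
  have "s \<notin> \<int>\<^sub>\<le>\<^sub>0" using assms by (auto elim!: nonpos_Ints_cases)
  then have "Gamma (1 + s) = s * Gamma s" using Gamma_plus1[of s] by (simp add: add.commute)
  then have "Gamma (1 + s) * Gamma (1 - s) = s * (of_real pi / sin (of_real pi * s))"
    using Gamma_reflection_complex[of s] by (simp only: mult.assoc)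
  then show ?thesis using assms(1) by (simp add: mb_integrand_def)
qed

text \<open>Cauchy's integral formula at 0 on the counterclockwise rectangle with vertical sides
  \<open>Re s = 1/2\<close> and \<open>Re s = - 1/2\<close>. The left side runs downwards, and this
  sign cancels the one in \<open>mb_integrand_diff_1\<close>, giving \<open>+ x\<close>.\<close>

lemma mb_integral_contour_shift:
  fixes \<beta> \<rho> x T :: real
  assumes x: "x > 0" and T: "T > 0"
  defines "F \<equiv> mb_integrand \<beta> \<rho> x"
  shows "contour_integral (linepath (Complex (- 1 / 2) (- T)) (Complex (1 / 2) (- T))) F
       + contour_integral (linepath (Complex (1 / 2) T) (Complex (- 1 / 2) T)) F
       + \<i> * (mb_integral \<beta> \<rho> x T + of_real x * mb_integral \<beta> (\<rho> + \<beta>) x T) = 2 * of_real pi * \<i> * of_real (rGamma \<rho>)"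
proof -
  \<comment> \<open>By reflection, \<open>h s / s = F s\<close>, and \<open>h\<close> is visibly holomorphic at \<open>0\<close>.\<close>
  define h where "h s = Gamma (1 + s) * Gamma (1 - s) * rGamma (of_real \<rho> - of_real \<beta> * s) * exp (- s * of_real (ln x))" for s :: complex
  define S :: "complex set" where "S = {s. \<bar>Re s\<bar> < 1}"
  let ?a1 = "Complex (- 1 / 2) (- T)" and ?a2 = "Complex (1 / 2) (- T)"
  let ?a3 = "Complex (1 / 2) T" and ?a4 = "Complex (- 1 / 2) T"
  let ?R = "rectpath ?a1 ?a3"
  have S: "S = {s. Re s < 1} \<inter> {s. Re s > -1}" by (auto simp: S_def)
  have "convex S" unfolding S by (intro convex_Int convex_halfspace_Re_lt convex_halfspace_Re_gt)
  have "open S" unfolding S by (intro open_Int open_halfspace_Re_lt open_halfspace_Re_gt)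
  have "h holomorphic_on S"
    unfolding h_def
  proof (intro holomorphic_intros)
    show "1 + s \<notin> \<int>\<^sub>\<le>\<^sub>0" "1 - s \<notin> \<int>\<^sub>\<le>\<^sub>0" if "s \<in> S" for s
      using that by (auto simp: S_def elim!: nonpos_Ints_cases dest!: arg_cong[of _ _ Re])
  qed
  have img: "path_image ?R \<subseteq> S - {0}"
    using T by (subst path_image_rectpath) (auto simp: S_def complex_eq_iff)
  have "((\<lambda>s. h s / (s - 0)) has_contour_integral (2 * pi * \<i> * winding_number ?R 0 * h 0)) ?R"
    by (rule Cauchy_integral_formula_convex_simple[of S])
       (use \<open>convex S\<close> \<open>open S\<close> \<open>h holomorphic_on S\<close> img in \<open>auto simp: interior_open S_def valid_path_rectpath\<close>)
  moreover have "winding_number ?R 0 = 1"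
    using T by (intro winding_number_rectpath) (auto simp: in_box_complex_iff)
  moreover have "h 0 = of_real (rGamma \<rho>)"
    by (simp add: h_def rGamma_complex_of_real)
  ultimately have "((\<lambda>s. h s / s) has_contour_integral (2 * of_real pi * \<i> * of_real (rGamma \<rho>))) ?R" by simp
  then have R: "(F has_contour_integral (2 * of_real pi * \<i> * of_real (rGamma \<rho>))) ?R"
  proof (rule has_contour_integral_eq)
    fix s assume "s \<in> path_image ?R"
    then have "s \<in> S - {0}" using img by blast
    then show "h s / s = F s"
      unfolding h_def F_def by (intro mb_integrand_residue) (auto simp: S_def)
  qed
  have cont: "continuous_on (path_image ?R) F"
    using img unfolding F_def S_def by (intro continuous_on_mb_integrand) auto
  have segs: "closed_segment ?a1 ?a2 \<subseteq> path_image ?R" "closed_segment ?a2 ?a3 \<subseteq> path_image ?R"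
      "closed_segment ?a3 ?a4 \<subseteq> path_image ?R" "closed_segment ?a4 ?a1 \<subseteq> path_image ?R"
    by (auto simp: rectpath_def Let_def path_image_join)
  have intg: "F contour_integrable_on linepath a b" if "closed_segment a b \<subseteq> path_image ?R" for a b
    by (intro contour_integrable_continuous_linepath continuous_on_subset[OF cont that])
  have "2 * of_real pi * \<i> * of_real (rGamma \<rho>) = contour_integral ?R F"
    using R by (simp add: contour_integral_unique)
  also have "\<dots> = contour_integral (linepath ?a1 ?a2) F + contour_integral (linepath ?a2 ?a3) F
      + contour_integral (linepath ?a3 ?a4) F + contour_integral (linepath ?a4 ?a1) F"
    using segs[THEN intg] by (simp add: rectpath_def Let_def contour_integrable_joinI)
  also have "contour_integral (linepath ?a2 ?a3) F = \<i> * mb_integral \<beta> \<rho> x T"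
    using T unfolding mb_integral_def F_def by (intro contour_integral_linepath_same_Re) auto
  also have "contour_integral (linepath ?a4 ?a1) F = - contour_integral (linepath ?a1 ?a4) F"
    using segs(4) by (intro contour_integral_reverse_linepath continuous_on_subset[OF cont])
  also have "contour_integral (linepath ?a1 ?a4) F = \<i> * integral {-T..T} (\<lambda>t. F (Complex (- 1 / 2) t))"
    using T by (intro contour_integral_linepath_same_Re) auto
  also have "integral {-T..T} (\<lambda>t. F (Complex (- 1 / 2) t)) = - of_real x * mb_integral \<beta> (\<rho> + \<beta>) x T"
  proof -
    have "F (Complex (- 1 / 2) t) = - of_real x * mb_integrand \<beta> (\<rho> + \<beta>) x (Complex (1 / 2) t)" for t
    proof -
      have "Complex (- 1 / 2) t = Complex (1 / 2) t - 1" by (simp add: complex_eq_iff)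
      then show ?thesis unfolding F_def by (simp only: mb_integrand_diff_1[OF x])
    qed
    then show ?thesis unfolding mb_integral_def by (simp add: integral_mult_right)
  qed
  finally show ?thesis by (simp add: algebra_simps)
qed

text \<open>The horizontal sides vanish in the limit. Convergence is claimed for the combination
  only, not for either integral separately.\<close>

lemma mb_integral_recurrence:
  assumes \<beta>: "0 < \<beta>" "\<beta> < 1" and x: "x > 0"
  shows "((\<lambda>T. mb_integral \<beta> \<rho> x T + of_real x * mb_integral \<beta> (\<rho> + \<beta>) x T)
            \<longlongrightarrow> of_real (2 * pi * rGamma \<rho>)) at_top"
proof -
  obtain C where C: "C > 0"
    "\<And>z. \<rho> - 1 \<le> Re z \<Longrightarrow> Re z \<le> \<rho> + 1 \<Longrightarrow> norm (rGamma z) \<le> C * exp (pi * \<bar>Im z\<bar>)"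
    by (rule rGamma_strip_bound) blast
  \<comment> \<open>\<open>B T\<close> bounds the integrand on a horizontal side, and these sides
    have length 1.\<close>
  define B where "B T = 2 * pi / (exp (pi * T) - 1) * (C * exp (pi * (\<beta> * T))) * exp \<bar>ln x\<bar>" for T
  have "((\<lambda>T. exp (pi * (\<beta> * T)) / (exp (pi * T) - 1)) \<longlongrightarrow> 0) at_top"
    using \<beta> by real_asymp
  then have "((\<lambda>T. 4 * pi * C * exp \<bar>ln x\<bar> * (exp (pi * (\<beta> * T)) / (exp (pi * T) - 1))) \<longlongrightarrow> 0) at_top"
    by (rule tendsto_mult_right_zero)
  then have lim: "((\<lambda>T. 2 * B T) \<longlongrightarrow> 0) at_top"
    by (simp add: B_def mult_ac)
  have "norm (mb_integral \<beta> \<rho> x T + of_real x * mb_integral \<beta> (\<rho> + \<beta>) x T - of_real (2 * pi * rGamma \<rho>)) \<le> 2 * B T"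
    if T: "T > 0" for T
  proof -
    let ?V = "mb_integral \<beta> \<rho> x T + of_real x * mb_integral \<beta> (\<rho> + \<beta>) x T"
    have hor: "norm (contour_integral (linepath (Complex a b) (Complex a' b)) (mb_integrand \<beta> \<rho> x)) \<le> B T"
      if "\<bar>b\<bar> = T" "\<bar>a\<bar> = 1 / 2" "a' = - a" for a a' b
    proof -
      have seg: "\<bar>Re s\<bar> \<le> 1 / 2 \<and> Im s = b" if "s \<in> closed_segment (Complex a b) (Complex a' b)" for s
        using that \<open>\<bar>a\<bar> = 1 / 2\<close> \<open>a' = - a\<close>
        by (auto simp: closed_segment_same_Im closed_segment_eq_real_ivl split: if_splits)
      have "mb_integrand \<beta> \<rho> x contour_integrable_on linepath (Complex a b) (Complex a' b)"
        using seg \<open>\<bar>b\<bar> = T\<close> T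
        by (intro contour_integrable_continuous_linepath continuous_on_mb_integrand) force
      then have "norm (contour_integral (linepath (Complex a b) (Complex a' b)) (mb_integrand \<beta> \<rho> x))
          \<le> B T * norm (Complex a' b - Complex a b)"
      proof (rule contour_integral_bound_linepath)
        show "0 \<le> B T" using C(1) T by (simp add: B_def)
        show "norm (mb_integrand \<beta> \<rho> x s) \<le> B T" if "s \<in> closed_segment (Complex a b) (Complex a' b)" for s
          unfolding B_def using seg[OF that] \<open>\<bar>b\<bar> = T\<close> \<beta> T C
          by (intro norm_mb_integrand_horizontal_le) auto
      qed
      moreover have "a = 1 / 2 \<or> a = - 1 / 2" using \<open>\<bar>a\<bar> = 1 / 2\<close> by linarith
      then have "norm (Complex a' b - Complex a b) = 1"
        using \<open>a' = - a\<close> by (elim disjE) (simp_all add: cmod_def)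
      ultimately show ?thesis by simp
    qed
    let ?b = "contour_integral (linepath (Complex (- 1 / 2) (- T)) (Complex (1 / 2) (- T))) (mb_integrand \<beta> \<rho> x)"
    let ?t = "contour_integral (linepath (Complex (1 / 2) T) (Complex (- 1 / 2) T)) (mb_integrand \<beta> \<rho> x)"
    have "\<i> * (?V - of_real (2 * pi * rGamma \<rho>)) = - (?b + ?t)"
      using mb_integral_contour_shift[OF x T, of \<beta> \<rho>] by (simp add: algebra_simps add_eq_0_iff2)
    then have "norm (\<i> * (?V - of_real (2 * pi * rGamma \<rho>))) = norm (?b + ?t)" by (simp only: norm_minus_cancel)
    also have "\<dots> \<le> norm ?b + norm ?t" by (rule norm_triangle_ineq)
    also have "\<dots> \<le> B T + B T" using T by (intro add_mono hor) auto
    finally show ?thesis by (simp add: norm_mult)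
  qed
  then have "eventually (\<lambda>T. norm (mb_integral \<beta> \<rho> x T + of_real x * mb_integral \<beta> (\<rho> + \<beta>) x T
      - of_real (2 * pi * rGamma \<rho>)) \<le> 2 * B T) at_top"
    by (rule eventually_mono[OF eventually_gt_at_top[of 0]])
  from Lim_null_comparison[OF this lim] show ?thesis by (simp add: LIM_zero_iff)
qed

section \<open>Asymptotics\<close>

text \<open>Adding \<open>(- x) ^ M\<close> times the recurrence at \<rho> + \<beta>M cancels the
  old remainder integral and leaves the next one, so the limits add up to a partial sum of the
  series.\<close>

lemma mb_integral_tendsto_partial_sum:
  assumes \<beta>: "0 < \<beta>" "\<beta> < 1" and x: "x > 0"
  shows "((\<lambda>T. mb_integral \<beta> \<rho> x T - of_real ((- x) ^ M) * mb_integral \<beta> (\<rho> + \<beta> * real M) x T)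
            \<longlongrightarrow> of_real (2 * pi * (\<Sum>j<M. (- x) ^ j * rGamma (\<beta> * real j + \<rho>)))) at_top"
proof (induction M)
  case (Suc M)
  let ?r = "\<rho> + \<beta> * real M"
  have "((\<lambda>T. mb_integral \<beta> \<rho> x T - of_real ((- x) ^ M) * mb_integral \<beta> ?r x T
            + of_real ((- x) ^ M) * (mb_integral \<beta> ?r x T + of_real x * mb_integral \<beta> (?r + \<beta>) x T))
          \<longlongrightarrow> of_real (2 * pi * (\<Sum>j<M. (- x) ^ j * rGamma (\<beta> * real j + \<rho>)))
            + of_real ((- x) ^ M) * of_real (2 * pi * rGamma ?r)) at_top"
    by (intro tendsto_add Suc.IH tendsto_mult tendsto_const mb_integral_recurrence \<beta> x)
  moreover have "?r + \<beta> = \<rho> + \<beta> * real (Suc M)" by (simp add: algebra_simps)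
  ultimately show ?case by (simp add: algebra_simps)
qed simp

text \<open>First \<open>T\<close>, then \<open>M\<close> tends to infinity in the preceding limit.
  The first integral is bounded uniformly in \<open>x\<close> and \<open>T\<close>, and for fixed
  \<open>x\<close> the remainder integral dies out as \<open>M\<close> grows.\<close>

lemma mittag_leffler_real_bounded:
  assumes \<beta>: "0 < \<beta>" "\<beta> < 1"
  obtains B where "\<And>x. x \<ge> 1 \<Longrightarrow> \<bar>mittag_leffler_real \<beta> \<rho> (- x)\<bar> \<le> B"
proof -
  obtain C1 where C1: "C1 > 0"
    "\<And>z. \<rho> - \<beta> / 2 \<le> Re z \<Longrightarrow> Re z \<le> \<rho> - \<beta> / 2 \<Longrightarrow> norm (rGamma z) \<le> C1 * exp (pi * \<bar>Im z\<bar>)"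
    by (rule rGamma_strip_bound) blast
  \<comment> \<open>The line \<open>Re z = \<beta> * M + \<rho> - \<beta> / 2\<close> moves to the
    right with \<open>M\<close>, so here a constant independent of \<open>M\<close> is
    required.\<close>
  obtain C2 where C2: "C2 > 0"
    "\<And>z::complex. Re z \<ge> 1 \<Longrightarrow> norm (rGamma z) \<le> C2 * rGamma (Re z) * exp (pi / 2 * \<bar>Im z\<bar>)"
    by (rule rGamma_half_plane_bound) blast
  define K1 K2 where "K1 = 4 * C1 / (1 - \<beta>)" and "K2 = 4 * C2 / (1 - \<beta>)"
  have K: "K1 > 0" "K2 > 0" using C1(1) C2(1) \<beta> by (auto simp: K1_def K2_def)
  have "2 * pi * \<bar>mittag_leffler_real \<beta> \<rho> (- x)\<bar> \<le> K1" if x: "x \<ge> 1" for x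
  proof -
    define S where "S M = (\<Sum>j<M. (- x) ^ j * rGamma (\<beta> * real j + \<rho>))" for M
    \<comment> \<open>Up to \<open>K2\<close>, this dominates the remainder. It is the general term
      of the convergent series with parameter \<rho> - \<beta>/2 at \<open>x\<close>, hence tends to
      0; the offset \<beta>/2 comes from the line \<open>Re s = 1/2\<close>.\<close>
    define u where "u M = x ^ M * rGamma (\<beta> * real M + (\<rho> - \<beta> / 2))" for M
    have le: "2 * pi * \<bar>S M\<bar> \<le> K1 + K2 * u M" if M: "\<beta> * real M + (\<rho> - \<beta> / 2) \<ge> 1" for M
    proof -
      let ?a = "\<beta> * real M + (\<rho> - \<beta> / 2)"
      have div: "a / sqrt x \<le> a" if "a \<ge> 0" for a
        using x that mult_left_mono[of 1 "sqrt x" a] by (simp add: divide_le_eq)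
      have pos: "rGamma ?a \<ge> 0" using M by (intro rGamma_real_nonneg) auto
      have "norm (mb_integral \<beta> \<rho> x T - of_real ((- x) ^ M) * mb_integral \<beta> (\<rho> + \<beta> * real M) x T)
              \<le> K1 + K2 * u M" if T: "T \<ge> 0" for T
      proof -
        have "norm (mb_integral \<beta> \<rho> x T) \<le> K1 / sqrt x"
          unfolding K1_def using \<beta> x T C1 by (intro norm_mb_integral_le) auto
        also have "\<dots> \<le> K1" using K by (intro div) auto
        finally have 1: "norm (mb_integral \<beta> \<rho> x T) \<le> K1" .
        have "norm (mb_integral \<beta> (\<rho> + \<beta> * real M) x T) \<le> 4 * (C2 * rGamma ?a) / (1 - \<beta>) / sqrt x"
        proof (rule norm_mb_integral_le)
          fix z :: complex assume z: "Re z = \<rho> + \<beta> * real M - \<beta> / 2"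
          then have a: "Re z = ?a" by simp
          then have "norm (rGamma z) \<le> C2 * rGamma ?a * exp (pi / 2 * \<bar>Im z\<bar>)"
            using C2(2)[of z] M by simp
          also have "\<dots> \<le> C2 * rGamma ?a * exp (pi * \<bar>Im z\<bar>)"
            using C2(1) pos by (intro mult_left_mono) (auto simp: mult_right_mono)
          finally show "norm (rGamma z) \<le> C2 * rGamma ?a * exp (pi * \<bar>Im z\<bar>)" .
        qed (use \<beta> x T in auto)
        also have "\<dots> \<le> 4 * (C2 * rGamma ?a) / (1 - \<beta>)"
          using \<beta> pos C2(1) by (intro div) auto
        also have "\<dots> = K2 * rGamma ?a" by (simp add: K2_def)
        finally have "x ^ M * norm (mb_integral \<beta> (\<rho> + \<beta> * real M) x T) \<le> x ^ M * (K2 * rGamma ?a)"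
          using x by (intro mult_left_mono) auto
        also have "\<dots> = K2 * u M" by (simp add: u_def)
        finally have 2: "x ^ M * norm (mb_integral \<beta> (\<rho> + \<beta> * real M) x T) \<le> K2 * u M" .
        from 1 2 have "norm (mb_integral \<beta> \<rho> x T) + norm (of_real ((- x) ^ M) * mb_integral \<beta> (\<rho> + \<beta> * real M) x T)
            \<le> K1 + K2 * u M"
          unfolding norm_mult norm_of_real power_abs using x by simp
        then show ?thesis by (rule order_trans[OF norm_triangle_ineq4])
      qed
      then have "eventually (\<lambda>T. norm (mb_integral \<beta> \<rho> x T
          - of_real ((- x) ^ M) * mb_integral \<beta> (\<rho> + \<beta> * real M) x T) \<le> K1 + K2 * u M) at_top"
        by (rule eventually_mono[OF eventually_ge_at_top[of 0]])
      moreover have "((\<lambda>T. mb_integral \<beta> \<rho> x T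
          - of_real ((- x) ^ M) * mb_integral \<beta> (\<rho> + \<beta> * real M) x T) \<longlongrightarrow> of_real (2 * pi * S M)) at_top"
        unfolding S_def using \<beta> x by (intro mb_integral_tendsto_partial_sum) auto
      ultimately have "norm (complex_of_real (2 * pi * S M)) \<le> K1 + K2 * u M"
        by (intro Lim_norm_ubound) auto
      then show ?thesis by (simp add: norm_mult abs_mult)
    qed
    have "S \<longlonglongrightarrow> mittag_leffler_real \<beta> \<rho> (- x)"
      using summable_LIMSEQ[OF summable_mittag_leffler_real[of \<beta> "- x" \<rho>]] \<beta>
      unfolding S_def mittag_leffler_real_def by auto
    then have "(\<lambda>M. 2 * pi * \<bar>S M\<bar>) \<longlonglongrightarrow> 2 * pi * \<bar>mittag_leffler_real \<beta> \<rho> (- x)\<bar>"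
      by (intro tendsto_intros)
    moreover have "u \<longlonglongrightarrow> 0"
      unfolding u_def using \<beta> by (intro summable_LIMSEQ_zero summable_mittag_leffler_real) auto
    then have "(\<lambda>M. K1 + K2 * u M) \<longlonglongrightarrow> K1 + K2 * 0"
      by (intro tendsto_intros)
    moreover have "filterlim (\<lambda>M. \<beta> * real M + (\<rho> - \<beta> / 2)) at_top sequentially"
      using \<beta> by real_asymp
    then have "eventually (\<lambda>M. \<beta> * real M + (\<rho> - \<beta> / 2) \<ge> 1) sequentially"
      by (simp add: filterlim_at_top)
    then have "eventually (\<lambda>M. 2 * pi * \<bar>S M\<bar> \<le> K1 + K2 * u M) sequentially"
      by (rule eventually_mono) (rule le)
    ultimately have "2 * pi * \<bar>mittag_leffler_real \<beta> \<rho> (- x)\<bar> \<le> K1 + K2 * 0"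
      by (intro tendsto_le[OF trivial_limit_sequentially])
    then show ?thesis by simp
  qed
  then have "\<bar>mittag_leffler_real \<beta> \<rho> (- x)\<bar> \<le> K1 / (2 * pi)" if "x \<ge> 1" for x
    using that by (simp add: field_simps)
  then show thesis by (rule that)
qed

text \<open>Expand exactly to order \<open>n\<close>: the remainder is bounded by the preceding
  lemma, and the term \<open>j = n\<close> is itself of the order of the error.\<close>

lemma mittag_leffler_real_asymptotic_expansion:
  assumes \<beta>: "0 < \<beta>" "\<beta> < 1"
  shows "(\<lambda>x. mittag_leffler_real \<beta> \<rho> (- x) + (\<Sum>j=1..<n. (- x) powi (- int j) * rGamma (\<rho> - \<beta> * real j)))
           \<in> O[at_top](\<lambda>x. x powi (- int n))"
proof -
  obtain B where B: "\<And>x. x \<ge> 1 \<Longrightarrow> \<bar>mittag_leffler_real \<beta> (\<rho> - \<beta> * real n) (- x)\<bar> \<le> B"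
    using mittag_leffler_real_bounded[OF \<beta>] by blast
  have "norm (mittag_leffler_real \<beta> \<rho> (- x) + (\<Sum>j=1..<n. (- x) powi (- int j) * rGamma (\<rho> - \<beta> * real j)))
      \<le> (B + \<bar>rGamma (\<rho> - \<beta> * real n)\<bar>) * norm (x powi (- int n))" if x: "x \<ge> 1" for x
  \<comment> \<open>The last term can be split off only if \<open>n > 0\<close>; for
    \<open>n = 0\<close> both index ranges are empty.\<close>
  proof (cases n)
    case 0
    then show ?thesis using B[OF x] by simp
  next
    case (Suc m)
    then have "{1..n} = insert n {1..<n}" by auto
    then have "mittag_leffler_real \<beta> \<rho> (- x) + (\<Sum>j=1..<n. (- x) powi (- int j) * rGamma (\<rho> - \<beta> * real j))
        = (- x) powi (- int n) * (mittag_leffler_real \<beta> (\<rho> - \<beta> * real n) (- x) - rGamma (\<rho> - \<beta> * real n))"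
      using mittag_leffler_real_expansion[of \<beta> "- x" \<rho> n] \<beta> x by (simp add: algebra_simps)
    also have "norm \<dots> = norm (x powi (- int n)) * \<bar>mittag_leffler_real \<beta> (\<rho> - \<beta> * real n) (- x) - rGamma (\<rho> - \<beta> * real n)\<bar>"
      by (simp add: abs_mult power_int_abs [symmetric] del: power_int_minus)
    also have "\<dots> \<le> norm (x powi (- int n)) * (B + \<bar>rGamma (\<rho> - \<beta> * real n)\<bar>)"
      using B[OF x] by (intro mult_left_mono) (auto intro: order_trans[OF abs_triangle_ineq4])
    finally show ?thesis by (simp add: mult.commute)
  qed
  then show ?thesis
    by (intro bigoI eventually_mono[OF eventually_ge_at_top[of 1]]) blast
qed

section \<open>The Debye function\<close>

lemma debye_grey_eq_mittag_leffler_real: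
  assumes "0 < \<beta>" "\<beta> \<le> 1"
  shows "debye_grey \<beta> y = 2 * mittag_leffler_real \<beta> 3 (- (y\<^sup>2))"
proof -
  have "rGamma (a + 3) = 1 / (Gamma (a + 1) * (a + 1) * (a + 2))" if "a \<ge> 0" for a :: real
  proof -
    have "a + 2 \<notin> \<int>\<^sub>\<le>\<^sub>0" "a + 1 \<notin> \<int>\<^sub>\<le>\<^sub>0" using that by (auto dest: nonpos_Ints_nonpos)
    then have "Gamma (a + 3) = (a + 2) * Gamma (a + 2)" "Gamma (a + 2) = (a + 1) * Gamma (a + 1)"
      using Gamma_plus1[of "a + 2"] Gamma_plus1[of "a + 1"] by (simp_all add: add.assoc)
    then show ?thesis by (simp add: rGamma_inverse_Gamma divide_inverse mult_ac)
  qed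
  from this[of "\<beta> * real j" for j] show ?thesis
    using assms by (simp add: debye_grey_def mittag_leffler_real_def)
qed

lemma debye_grey_asymptotic_expansion:
  assumes \<beta>: "0 < \<beta>" "\<beta> < 1"
  shows "(\<lambda>y. debye_grey \<beta> y
                - (- 2 * (\<Sum>j=1..N-1. (- (y\<^sup>2)) powi (- int j) * rGamma (3 - \<beta> * real j))))
         \<in> O[at_top](\<lambda>y. y powi (- 2 * int N))"
proof -
  have "filterlim (\<lambda>y::real. y\<^sup>2) at_top at_top" by real_asymp
  from landau_o.big.compose[OF mittag_leffler_real_asymptotic_expansion[OF \<beta>, of 3 N] this]
  have "(\<lambda>y. 2 * (mittag_leffler_real \<beta> 3 (- (y\<^sup>2)) + (\<Sum>j=1..<N. (- (y\<^sup>2)) powi (- int j) * rGamma (3 - \<beta> * real j))))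
          \<in> O[at_top](\<lambda>y. (y\<^sup>2) powi (- int N))"
    by (subst landau_o.big.cmult_in_iff) auto
  moreover have "(y\<^sup>2) powi (- int N) = y powi (- 2 * int N)" for y :: real
    using power_int_mult[of y 2 "- int N"] by simp
  \<comment> \<open>This includes \<open>N = 0\<close>, where truncated subtraction makes both sides
    empty.\<close>
  moreover have "{1..<N} = {1..N-1}" by auto
  moreover have "debye_grey \<beta> = (\<lambda>y. 2 * mittag_leffler_real \<beta> 3 (- (y\<^sup>2)))"
    using \<beta> by (simp add: fun_eq_iff debye_grey_eq_mittag_leffler_real)
  ultimately show ?thesis by (simp add: algebra_simps)
qed

text \<open>Take \<open>N = 2\<close>: the sum reduces to \<open>j = 1\<close>, whose two minus
  signs cancel, and the error is of order \<open>y powi (- 4)\<close>. The leading coefficient is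
  nonzero since \<open>Gamma (3 - \<beta>) > 0\<close>.\<close>

lemma debye_grey_asymp_equiv:
  assumes \<beta>: "0 < \<beta>" "\<beta> < 1"
  shows "debye_grey \<beta> \<sim>[at_top] (\<lambda>y. 2 / Gamma (3 - \<beta>) * y powi (- 2))"
proof (rule smallo_imp_asymp_equiv)
  have pos: "Gamma (3 - \<beta>) > 0" using \<beta> by (intro Gamma_real_pos) auto
  have "(\<lambda>y. debye_grey \<beta> y - 2 / Gamma (3 - \<beta>) * y powi (- 2)) \<in> O[at_top](\<lambda>y. y powi (- 4))"
    using debye_grey_asymptotic_expansion[OF \<beta>, of 2]
    by (simp add: rGamma_inverse_Gamma power_int_minus divide_inverse mult_ac)
  also have "(\<lambda>y::real. y powi (- 4)) \<in> o[at_top](\<lambda>y. y powi (- 2))"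
    unfolding power_int_minus power_int_numeral by real_asymp
  also have "(\<lambda>y::real. y powi (- 2)) \<in> O[at_top](\<lambda>y. 2 / Gamma (3 - \<beta>) * y powi (- 2))"
    using pos by (subst landau_o.big.cmult) auto
  finally show "(\<lambda>y. debye_grey \<beta> y - 2 / Gamma (3 - \<beta>) * y powi (- 2))
      \<in> o[at_top](\<lambda>y. 2 / Gamma (3 - \<beta>) * y powi (- 2))" .
qed

text \<open>Since \<open>Gamma (n + 3) = fact (n + 2)\<close>, the series is the exponential series
  at \<open>z = - (y\<^sup>2)\<close> without its first two terms, divided by
  \<open>z\<^sup>2 = y ^ 4\<close>.\<close>

lemma debye_grey_1:
  assumes "y > 0"
  shows "debye_grey 1 y = 2 / y ^ 4 * (exp (- (y\<^sup>2)) - 1 + y\<^sup>2)"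
proof -
  let ?z = "- (y\<^sup>2)"
  have "(\<lambda>n. ?z ^ n / fact n) sums exp ?z"
    using exp_converges[of ?z] by (simp add: scaleR_conv_of_real field_simps)
  then have "(\<lambda>n. ?z ^ (n + 2) / fact (n + 2)) sums (exp ?z - (\<Sum>n<2. ?z ^ n / fact n))"
    by (rule sums_split_initial_segment)
  then have "(\<lambda>n. ?z ^ (n + 2) / fact (n + 2) / y ^ 4) sums ((exp ?z - 1 + y\<^sup>2) / y ^ 4)"
    by (intro sums_divide) (simp add: numeral_2_eq_2 algebra_simps)
  moreover have "?z ^ (n + 2) / fact (n + 2) / y ^ 4 = ?z ^ n * rGamma (1 * real n + 3)" for n
  proof -
    have "Gamma (real n + 3) = fact (n + 2)"
      using Gamma_fact[of "n + 2", where 'a = real] by (simp add: add_ac)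
    moreover have "?z ^ (n + 2) = ?z ^ n * y ^ 4" by (simp add: power_add)
    ultimately show ?thesis using assms by (simp add: rGamma_inverse_Gamma divide_inverse)
  qed
  ultimately have "mittag_leffler_real 1 3 ?z = (exp ?z - 1 + y\<^sup>2) / y ^ 4"
    unfolding mittag_leffler_real_def by (simp add: sums_iff)
  then show ?thesis by (simp add: debye_grey_eq_mittag_leffler_real)
qed

theorem mainTheorem4:
  "(\<forall>\<beta>::real. 0 < \<beta> \<and> \<beta> < 1 \<longrightarrow>
      (\<forall>y>0. complex_of_real (debye_grey \<beta> y) = 2 * mittag_leffler \<beta> 3 (- (complex_of_real y)\<^sup>2)) \<and>
      (\<forall>N::nat. N \<ge> 2 \<longrightarrow>
         (\<lambda>y. debye_grey \<beta> y
                - (- 2 * (\<Sum>j=1..N-1. (- (y\<^sup>2)) powi (- int j) * rGamma (3 - \<beta> * real j))))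
         \<in> O[at_top](\<lambda>y. y powi (- 2 * int N))) \<and>
      debye_grey \<beta> \<sim>[at_top] (\<lambda>y. 2 / Gamma (3 - \<beta>) * y powi (- 2))) \<and>
   (\<forall>y>0. debye_grey 1 y = 2 / y ^ 4 * (exp (- (y\<^sup>2)) - 1 + y\<^sup>2)) \<and>
   debye_grey 1 \<sim>[at_top] (\<lambda>y. 2 * y powi (- 2))"
proof (intro conjI allI impI; (elim conjE)?)
  fix \<beta> y :: real assume \<beta>: "0 < \<beta>" "\<beta> < 1"
  show "complex_of_real (debye_grey \<beta> y) = 2 * mittag_leffler \<beta> 3 (- (complex_of_real y)\<^sup>2)"
    using mittag_leffler_of_real[of \<beta> 3 "- (y\<^sup>2)"] \<beta> by (simp add: debye_grey_eq_mittag_leffler_real)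
next
  have "eventually (\<lambda>y. debye_grey 1 y = 2 / y ^ 4 * (exp (- (y\<^sup>2)) - 1 + y\<^sup>2)) at_top"
    using eventually_gt_at_top[of 0] by eventually_elim (rule debye_grey_1)
  moreover have "(\<lambda>y::real. 2 / y ^ 4 * (exp (- (y\<^sup>2)) - 1 + y\<^sup>2)) \<sim>[at_top] (\<lambda>y. 2 * y powi (- 2))"
    unfolding power_int_minus power_int_numeral by real_asymp
  ultimately show "debye_grey 1 \<sim>[at_top] (\<lambda>y. 2 * y powi (- 2))"
    by (subst asymp_equiv_cong) auto
qed (use debye_grey_asymptotic_expansion debye_grey_asymp_equiv debye_grey_1 in auto)

end
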